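(* Let $$\mathit{add}:=\lambda\lambda\,\bigl(\mathcal R\cdot v_1\cdot(\lambda\lambda\,\mathbf S v_0)\cdot v_0\bigr),\qquad \mathit{mult}:=\lambda\lambda\,\bigl(\mathcal R\cdot\mathbf 0\cdot(\lambda\lambda\,(\mathit{add}\cdot v_3\cdot v_0))\cdot v_0\bigr)$$ (that is, $\mathit{add}=\lambda x\,y.\,\mathcal R\cdot x\cdot(\lambda k\,r.\,\mathbf S r)\cdot y$ and $\mathit{mult}=\lambda x\,y.\,\mathcal R\cdot\mathbf 0\cdot(\lambda k\,r.\,\mathit{add}\cdot x\cdot r)\cdot y$). Then both judgments $$\emptyset\vdash\forall.\forall.\,(\mathit{add}\cdot v_1\cdot v_0)\,\mathsf N\qquad\text{and}\qquad\emptyset\vdash\forall.\forall.\,(\mathit{mult}\cdot v_1\cdot v_0)\,\mathsf N$$ are derivable in RGA.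
   Context: **Terms.** Raw terms are: variables $v_i$ ($i\in\mathbb N$, de Bruijn indices), and operator nodes, each consisting of an operator code, a binder count $k\in\mathbb N$ and a finite list of raw terms as arguments, in each of which the $k$ lowest indices are bound. RGA has ten operators: constants $\bot$, $\mathbf 0$, $\mathcal R$ (recursor), $\mathcal A$ (universal quantifier combinator); unary $\mathbf S$, $\neg$; unary $\lambda$ (binder count 1, the only binder); binary $=$, $\lor$, and application $\cdot$ (left associative). A term $t$ is well-formed, $\mathrm{wf}(t)$, iff it is built from variables and these ten operators at these arities and binder counts. "Term" means raw term; formulas are just terms. Closed means having no free variables. $\underline n=\mathbf S^n\mathbf 0$ is the numeral of $n$. $[v_i\mapsto s]t$ (also $[i\mapsto s]t$): capture-avoiding replacement of the free variable $v_i$ by $s$, other free variables unchanged. $b[t]$: $\beta$-instance, replacing index $0$ in $b$ by $t$ and decrementing all other free indices. $\uparrow t$: all free indices increased by one; $\uparrow\Gamma$ elementwise. $\mathrm{fv}$: set of free variables. Abbreviations: $t\neq u:=\neg(t=u)$; $t\,\mathsf N:=(t=t)$; $t\,\mathsf B:=(t\lor\neg t)$; $t\land u:=\neg(\neg t\lor\neg u)$; $\forall.\,b:=\mathcal A\cdot(\lambda b)$ (quantifying the de Bruijn variable $0$ of $b$). **Head steps** $t\triangleright t'$ (syntactic relation): $(\lambda b)\cdot t\triangleright b[t]$ if $\mathrm{wf}(t)$; $\mathcal R\cdot g\cdot h\cdot\mathbf 0\triangleright g$ if $\mathrm{wf}(h)$; $\mathcal R\cdot g\cdot h\cdot(\mathbf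 S\,\underline n)\triangleright h\cdot\underline n\cdot(\mathcal R\cdot g\cdot h\cdot\underline n)$ if $\mathrm{wf}(g)$; and $t\cdot u\triangleright t'\cdot u$ if $t\triangleright t'$. **Proofs.** A judgment $\Gamma\vdash c$ has a finite set $\Gamma$ of terms and a term $c$. A proof is a finite list of judgments each following from earlier entries by one rule below; a judgment is derivable if some proof contains it. Writing $\Gamma\vdash c$ as an assertion means derivability. Rules ($\Rightarrow$ from premises to conclusion, $\Leftrightarrow$ both directions): Structural: $\mathrm{wf}(c)\Rightarrow\Gamma,c\vdash c$; $\Gamma\vdash c\Rightarrow\Gamma,a\vdash c$; $\Gamma\vdash a$ and $\Gamma,a\vdash c\Rightarrow\Gamma\vdash c$; $\Gamma\vdash c$ with $\Gamma,c,s$ well-formed $\Rightarrow[v\mapsto s]\Gamma\vdash[v\mapsto s]c$. Truth values: $\Gamma\vdash a\Leftrightarrow\Gamma\vdash a=\underline 1$; $\Gamma\vdash\neg a\Leftrightarrow\Gamma\vdash a=\underline 0$. Negation: $\Gamma\vdash\neg a$, $\Gamma\vdash a$, $\mathrm{wf}(c)\Rightarrow\Gamma\vdash c$; $\Gamma\vdash a\Leftrightarrow\Gamma\vdash\neg\neg a$. Disjunction: $\Gamma\vdash a$, $\mathrm{wf}(b)\Rightarrow\Gamma\vdash a\lor b$; $\Gamma\vdash b$, $\mathrm{wf}(a)\Rightarrow\Gamma\vdash a\lor b$; $\Gamma\vdash\neg a$, $\Gamma\vdash\neg b\Rightarrow\Gamma\vdash\neg(a\lor b)$; $\Gamma\vdash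 a\lor b$, $\Gamma,a\vdash c$, $\Gamma,b\vdash c\Rightarrow\Gamma\vdash c$; $\Gamma\vdash\neg(a\lor b)\Rightarrow\Gamma\vdash\neg a$, and $\Rightarrow\Gamma\vdash\neg b$. Equality: $\Gamma\vdash a\,\mathsf N\Leftrightarrow\Gamma\vdash a=a$; $\Gamma\vdash a=b\Rightarrow\Gamma\vdash b=a$; $\Gamma\vdash a=b$, $\Gamma\vdash[v\mapsto a]p$, $\mathrm{wf}(p)\Rightarrow\Gamma\vdash[v\mapsto b]p$; $\Gamma\vdash a\ne b\Rightarrow\Gamma\vdash b\ne a$; $\Gamma\vdash a\,\mathsf N$, $\Gamma\vdash b\,\mathsf N\Rightarrow\Gamma\vdash(a=b)\,\mathsf B$; $\Gamma\vdash(a=b)\,\mathsf B\Rightarrow\Gamma\vdash(a\,\mathsf N)\land(b\,\mathsf N)$. Naturals: $\Gamma\vdash\mathbf 0\,\mathsf N$; $\Gamma\vdash a\,\mathsf N\Leftrightarrow\Gamma\vdash\mathbf S a\,\mathsf N$; $\Gamma\vdash a\,\mathsf N\Rightarrow\Gamma\vdash\mathbf S a\ne\mathbf 0$; $\Gamma\vdash a\ne b\Leftrightarrow\Gamma\vdash\mathbf S a\ne\mathbf S b$; $\Gamma\vdash\mathbf S a=\mathbf S b\Rightarrow\Gamma\vdash a=b$; $\Gamma\vdash\bot\,\mathsf N$, $\mathrm{wf}(p)\Rightarrow\Gamma\vdash p$. Induction: $\Gamma\vdash[i\mapsto\mathbf 0]c$; $v_i\,\mathsf N,c,\Gamma\vdash[i\mapsto\mathbf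 S v_i]c$; $\Gamma\vdash a\,\mathsf N$; $\mathrm{wf}(c)$; $i\notin\mathrm{fv}(\Gamma)$ $\Rightarrow\Gamma\vdash[i\mapsto a]c$. Conversion: if $c\triangleright c'$: $\Gamma\vdash c'\Leftrightarrow\Gamma\vdash c$; $\Gamma\vdash c'\,\mathsf N\Rightarrow\Gamma\vdash c=c'$. Recursor: $\Gamma\vdash m\,\mathsf N$, $\Gamma\vdash(h\cdot m\cdot(\mathcal R\cdot g\cdot h\cdot m))\,\mathsf N$, $\mathrm{wf}(g)\Rightarrow\Gamma\vdash\mathcal R\cdot g\cdot h\cdot(\mathbf S m)=h\cdot m\cdot(\mathcal R\cdot g\cdot h\cdot m)$. Quantifier: $v_0\,\mathsf N,\uparrow\Gamma\vdash\uparrow f\cdot v_0\Rightarrow\Gamma\vdash\mathcal A\cdot f$; $\Gamma\vdash\mathcal A\cdot f$, $\Gamma\vdash a\,\mathsf N\Rightarrow\Gamma\vdash f\cdot a$; $\Gamma\vdash\neg(f\cdot a)$, $\Gamma\vdash a\,\mathsf N\Rightarrow\Gamma\vdash\neg(\mathcal A\cdot f)$; $\Gamma\vdash\neg(\mathcal A\cdot f)$ and $v_0\,\mathsf N,\neg(\uparrow f\cdot v_0),\uparrow\Gamma\vdash\uparrow c\Rightarrow\Gamma\vdash c$. *)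

theory Defs
  imports Main "HOL-Library.FSet"
begin

text \<open>
  The node \<open>Op f k ts\<close> has operator code \<open>f\<close>, binder count \<open>k\<close> and arguments \<open>ts\<close>, in each of
  which the indices \<open>0, \<dots>, k - 1\<close> are bound.  Operator codes are arbitrary natural numbers;
  the ten operators of RGA get the codes \<open>0, \<dots>, 9\<close>.  The numbering itself is immaterial.
\<close>

datatype rterm = Var nat | Op nat nat "rterm list"

abbreviation Bot :: rterm where "Bot \<equiv> Op 0 0 []"
abbreviation Zero :: rterm where "Zero \<equiv> Op 1 0 []"
abbreviation Rec :: rterm where "Rec \<equiv> Op 2 0 []"
abbreviation AllC :: rterm where "AllC \<equiv> Op 3 0 []"
abbreviation Succ :: "rterm \<Rightarrow> rterm" where "Succ t \<equiv> Op 4 0 [t]"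
abbreviation Neg :: "rterm \<Rightarrow> rterm"  (\<open>\<^bold>\<not> _\<close> [75] 75) where "\<^bold>\<not> t \<equiv> Op 5 0 [t]"
abbreviation Lam :: "rterm \<Rightarrow> rterm" where "Lam b \<equiv> Op 6 1 [b]"
abbreviation Eq :: "rterm \<Rightarrow> rterm \<Rightarrow> rterm"  (infix \<open>\<^bold>=\<close> 80) where "t \<^bold>= u \<equiv> Op 7 0 [t, u]"
abbreviation Or :: "rterm \<Rightarrow> rterm \<Rightarrow> rterm"  (infixr \<open>\<^bold>\<or>\<close> 70) where "t \<^bold>\<or> u \<equiv> Op 8 0 [t, u]"
abbreviation App :: "rterm \<Rightarrow> rterm \<Rightarrow> rterm"  (infixl \<open>\<cdot>\<close> 90) where "t \<cdot> u \<equiv> Op 9 0 [t, u]"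

inductive wf_tm :: "rterm \<Rightarrow> bool" where
  "wf_tm (Var i)"
| "wf_tm Bot"
| "wf_tm Zero"
| "wf_tm Rec"
| "wf_tm AllC"
| "wf_tm t \<Longrightarrow> wf_tm (Succ t)"
| "wf_tm t \<Longrightarrow> wf_tm (\<^bold>\<not> t)"
| "wf_tm b \<Longrightarrow> wf_tm (Lam b)"
| "wf_tm t \<Longrightarrow> wf_tm u \<Longrightarrow> wf_tm (t \<^bold>= u)"
| "wf_tm t \<Longrightarrow> wf_tm u \<Longrightarrow> wf_tm (t \<^bold>\<or> u)"
| "wf_tm t \<Longrightarrow> wf_tm u \<Longrightarrow> wf_tm (t \<cdot> u)"

fun fv :: "rterm \<Rightarrow> nat set" where
  "fv (Var i) = {i}"
| "fv (Op f k ts) = {i. \<exists>t\<in>set ts. i + k \<in> fv t}"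

text \<open>\<open>lift d c t\<close> increases by \<open>d\<close> every free index of \<open>t\<close> that is at least \<open>c\<close>.\<close>

fun lift :: "nat \<Rightarrow> nat \<Rightarrow> rterm \<Rightarrow> rterm" where
  "lift d c (Var j) = Var (if j < c then j else j + d)"
| "lift d c (Op f k ts) = Op f k (map (lift d (c + k)) ts)"

abbreviation up :: "rterm \<Rightarrow> rterm" where "up t \<equiv> lift 1 0 t"

text \<open>\<open>tsubst i s t\<close> is \<open>[v\<^sub>i \<mapsto> s]t\<close>: the other free indices are left unchanged.\<close>

fun tsubst :: "nat \<Rightarrow> rterm \<Rightarrow> rterm \<Rightarrow> rterm" where
  "tsubst i s (Var j) = (if j = i then s else Var j)"
| "tsubst i s (Op f k ts) = Op f k (map (tsubst (i + k) (lift k 0 s)) ts)"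

text \<open>\<open>inst i s b\<close> replaces index \<open>i\<close> by \<open>s\<close> and decrements the free indices above \<open>i\<close>;
  the beta-instance \<open>b[t]\<close> is \<open>inst 0 t b\<close>.\<close>

fun inst :: "nat \<Rightarrow> rterm \<Rightarrow> rterm \<Rightarrow> rterm" where
  "inst i s (Var j) = (if j < i then Var j else if j = i then s else Var (j - 1))"
| "inst i s (Op f k ts) = Op f k (map (inst (i + k) (lift k 0 s)) ts)"

definition num_tm :: "nat \<Rightarrow> rterm" where
  "num_tm n = ((\<lambda>t. Succ t) ^^ n) Zero"

abbreviation Neq :: "rterm \<Rightarrow> rterm \<Rightarrow> rterm"  (infix \<open>\<^bold>\<noteq>\<close> 80) where
  "t \<^bold>\<noteq> u \<equiv> \<^bold>\<not> (t \<^bold>= u)"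
abbreviation IsN :: "rterm \<Rightarrow> rterm" where
  "IsN t \<equiv> t \<^bold>= t"
abbreviation IsB :: "rterm \<Rightarrow> rterm" where
  "IsB t \<equiv> t \<^bold>\<or> \<^bold>\<not> t"
abbreviation And :: "rterm \<Rightarrow> rterm \<Rightarrow> rterm"  (infixr \<open>\<^bold>\<and>\<close> 72) where
  "t \<^bold>\<and> u \<equiv> \<^bold>\<not> (\<^bold>\<not> t \<^bold>\<or> \<^bold>\<not> u)"
abbreviation Forall :: "rterm \<Rightarrow> rterm" where
  "Forall b \<equiv> AllC \<cdot> Lam b"

inductive head_step :: "rterm \<Rightarrow> rterm \<Rightarrow> bool"  (infix \<open>\<rhd>\<close> 50) where
  beta: "wf_tm t \<Longrightarrow> Lam b \<cdot> t \<rhd> inst 0 t b"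
| rec_zero: "wf_tm h \<Longrightarrow> Rec \<cdot> g \<cdot> h \<cdot> Zero \<rhd> g"
| rec_succ: "wf_tm g \<Longrightarrow>
    Rec \<cdot> g \<cdot> h \<cdot> Succ (num_tm n) \<rhd> h \<cdot> num_tm n \<cdot> (Rec \<cdot> g \<cdot> h \<cdot> num_tm n)"
| app: "t \<rhd> t' \<Longrightarrow> t \<cdot> u \<rhd> t' \<cdot> u"

type_synonym sequent = "rterm fset \<times> rterm"

text \<open>\<open>follows P J\<close>: the sequent \<open>J\<close> follows by one application of a rule whose premises
  all lie in \<open>P\<close>.\<close>

inductive follows :: "sequent set \<Rightarrow> sequent \<Rightarrow> bool" for P :: "sequent set" where
  hyp: "wf_tm c \<Longrightarrow> follows P (finsert c \<Gamma>, c)"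
| weaken: "(\<Gamma>, c) \<in> P \<Longrightarrow> follows P (finsert a \<Gamma>, c)"
| cut: "(\<Gamma>, a) \<in> P \<Longrightarrow> (finsert a \<Gamma>, c) \<in> P \<Longrightarrow> follows P (\<Gamma>, c)"
| substI: "(\<Gamma>, c) \<in> P \<Longrightarrow> (\<forall>g. g |\<in>| \<Gamma> \<longrightarrow> wf_tm g) \<Longrightarrow> wf_tm c \<Longrightarrow> wf_tm s \<Longrightarrow>
    follows P (tsubst v s |`| \<Gamma>, tsubst v s c)"
| true_eqI: "(\<Gamma>, a) \<in> P \<Longrightarrow> follows P (\<Gamma>, a \<^bold>= num_tm 1)"
| true_eqD: "(\<Gamma>, a \<^bold>= num_tm 1) \<in> P \<Longrightarrow> follows P (\<Gamma>, a)"
| false_eqI: "(\<Gamma>, \<^bold>\<not> a) \<in> P \<Longrightarrow> follows P (\<Gamma>, a \<^bold>= num_tm 0)"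
| false_eqD: "(\<Gamma>, a \<^bold>= num_tm 0) \<in> P \<Longrightarrow> follows P (\<Gamma>, \<^bold>\<not> a)"
| contr: "(\<Gamma>, \<^bold>\<not> a) \<in> P \<Longrightarrow> (\<Gamma>, a) \<in> P \<Longrightarrow> wf_tm c \<Longrightarrow> follows P (\<Gamma>, c)"
| negnegI: "(\<Gamma>, a) \<in> P \<Longrightarrow> follows P (\<Gamma>, \<^bold>\<not> (\<^bold>\<not> a))"
| negnegD: "(\<Gamma>, \<^bold>\<not> (\<^bold>\<not> a)) \<in> P \<Longrightarrow> follows P (\<Gamma>, a)"
| orI1: "(\<Gamma>, a) \<in> P \<Longrightarrow> wf_tm b \<Longrightarrow> follows P (\<Gamma>, a \<^bold>\<or> b)"
| orI2: "(\<Gamma>, b) \<in> P \<Longrightarrow> wf_tm a \<Longrightarrow> follows P (\<Gamma>, a \<^bold>\<or> b)"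
| norI: "(\<Gamma>, \<^bold>\<not> a) \<in> P \<Longrightarrow> (\<Gamma>, \<^bold>\<not> b) \<in> P \<Longrightarrow> follows P (\<Gamma>, \<^bold>\<not> (a \<^bold>\<or> b))"
| orE: "(\<Gamma>, a \<^bold>\<or> b) \<in> P \<Longrightarrow> (finsert a \<Gamma>, c) \<in> P \<Longrightarrow> (finsert b \<Gamma>, c) \<in> P \<Longrightarrow>
    follows P (\<Gamma>, c)"
| norD1: "(\<Gamma>, \<^bold>\<not> (a \<^bold>\<or> b)) \<in> P \<Longrightarrow> follows P (\<Gamma>, \<^bold>\<not> a)"
| norD2: "(\<Gamma>, \<^bold>\<not> (a \<^bold>\<or> b)) \<in> P \<Longrightarrow> follows P (\<Gamma>, \<^bold>\<not> b)"
| isN_eqI: "(\<Gamma>, IsN a) \<in> P \<Longrightarrow> follows P (\<Gamma>, a \<^bold>= a)"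
| isN_eqD: "(\<Gamma>, a \<^bold>= a) \<in> P \<Longrightarrow> follows P (\<Gamma>, IsN a)"
| eq_sym: "(\<Gamma>, a \<^bold>= b) \<in> P \<Longrightarrow> follows P (\<Gamma>, b \<^bold>= a)"
| eq_subst: "(\<Gamma>, a \<^bold>= b) \<in> P \<Longrightarrow> (\<Gamma>, tsubst v a p) \<in> P \<Longrightarrow> wf_tm p \<Longrightarrow>
    follows P (\<Gamma>, tsubst v b p)"
| neq_sym: "(\<Gamma>, a \<^bold>\<noteq> b) \<in> P \<Longrightarrow> follows P (\<Gamma>, b \<^bold>\<noteq> a)"
| eq_boolI: "(\<Gamma>, IsN a) \<in> P \<Longrightarrow> (\<Gamma>, IsN b) \<in> P \<Longrightarrow> follows P (\<Gamma>, IsB (a \<^bold>= b))"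
| eq_boolD: "(\<Gamma>, IsB (a \<^bold>= b)) \<in> P \<Longrightarrow> follows P (\<Gamma>, IsN a \<^bold>\<and> IsN b)"
| zero_N: "follows P (\<Gamma>, IsN Zero)"
| succ_NI: "(\<Gamma>, IsN a) \<in> P \<Longrightarrow> follows P (\<Gamma>, IsN (Succ a))"
| succ_ND: "(\<Gamma>, IsN (Succ a)) \<in> P \<Longrightarrow> follows P (\<Gamma>, IsN a)"
| succ_neq_zero: "(\<Gamma>, IsN a) \<in> P \<Longrightarrow> follows P (\<Gamma>, Succ a \<^bold>\<noteq> Zero)"
| succ_neqI: "(\<Gamma>, a \<^bold>\<noteq> b) \<in> P \<Longrightarrow> follows P (\<Gamma>, Succ a \<^bold>\<noteq> Succ b)"
| succ_neqD: "(\<Gamma>, Succ a \<^bold>\<noteq> Succ b) \<in> P \<Longrightarrow> follows P (\<Gamma>, a \<^bold>\<noteq> b)"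
| succ_inj: "(\<Gamma>, Succ a \<^bold>= Succ b) \<in> P \<Longrightarrow> follows P (\<Gamma>, a \<^bold>= b)"
| bot_N: "(\<Gamma>, IsN Bot) \<in> P \<Longrightarrow> wf_tm p \<Longrightarrow> follows P (\<Gamma>, p)"
| induction: "(\<Gamma>, tsubst i Zero c) \<in> P \<Longrightarrow>
    (finsert (IsN (Var i)) (finsert c \<Gamma>), tsubst i (Succ (Var i)) c) \<in> P \<Longrightarrow>
    (\<Gamma>, IsN a) \<in> P \<Longrightarrow> wf_tm c \<Longrightarrow> (\<forall>g. g |\<in>| \<Gamma> \<longrightarrow> i \<notin> fv g) \<Longrightarrow>
    follows P (\<Gamma>, tsubst i a c)"
| convI: "c \<rhd> c' \<Longrightarrow> (\<Gamma>, c') \<in> P \<Longrightarrow> follows P (\<Gamma>, c)"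
| convD: "c \<rhd> c' \<Longrightarrow> (\<Gamma>, c) \<in> P \<Longrightarrow> follows P (\<Gamma>, c')"
| conv_eq: "c \<rhd> c' \<Longrightarrow> (\<Gamma>, IsN c') \<in> P \<Longrightarrow> follows P (\<Gamma>, c \<^bold>= c')"
| recursor: "(\<Gamma>, IsN m) \<in> P \<Longrightarrow> (\<Gamma>, IsN (h \<cdot> m \<cdot> (Rec \<cdot> g \<cdot> h \<cdot> m))) \<in> P \<Longrightarrow> wf_tm g \<Longrightarrow>
    follows P (\<Gamma>, Rec \<cdot> g \<cdot> h \<cdot> Succ m \<^bold>= h \<cdot> m \<cdot> (Rec \<cdot> g \<cdot> h \<cdot> m))"
| allI: "(finsert (IsN (Var 0)) (up |`| \<Gamma>), up f \<cdot> Var 0) \<in> P \<Longrightarrow> follows P (\<Gamma>, AllC \<cdot> f)"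
| allD: "(\<Gamma>, AllC \<cdot> f) \<in> P \<Longrightarrow> (\<Gamma>, IsN a) \<in> P \<Longrightarrow> follows P (\<Gamma>, f \<cdot> a)"
| nallI: "(\<Gamma>, \<^bold>\<not> (f \<cdot> a)) \<in> P \<Longrightarrow> (\<Gamma>, IsN a) \<in> P \<Longrightarrow> follows P (\<Gamma>, \<^bold>\<not> (AllC \<cdot> f))"
| nallE: "(\<Gamma>, \<^bold>\<not> (AllC \<cdot> f)) \<in> P \<Longrightarrow>
    (finsert (IsN (Var 0)) (finsert (\<^bold>\<not> (up f \<cdot> Var 0)) (up |`| \<Gamma>)), up c) \<in> P \<Longrightarrow>
    follows P (\<Gamma>, c)"

definition is_proof :: "sequent list \<Rightarrow> bool" where
  "is_proof js \<longleftrightarrow> (\<forall>n<length js. follows (set (take n js)) (js ! n))"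

definition derivable :: "rterm fset \<Rightarrow> rterm \<Rightarrow> bool"  (infix \<open>\<turnstile>\<close> 50) where
  "\<Gamma> \<turnstile> c \<longleftrightarrow> (\<exists>js. is_proof js \<and> (\<Gamma>, c) \<in> set js)"

definition add_tm :: rterm where
  "add_tm = Lam (Lam (Rec \<cdot> Var 1 \<cdot> Lam (Lam (Succ (Var 0))) \<cdot> Var 0))"

definition mult_tm :: rterm where
  "mult_tm = Lam (Lam (Rec \<cdot> Zero \<cdot> Lam (Lam (add_tm \<cdot> Var 3 \<cdot> Var 0)) \<cdot> Var 0))"

end

theory Submission
  imports Defs
begin

text \<open>
  Truth of \<open>IsN t\<close> says that \<open>t\<close> denotes a natural number, so the theorem states totality of
  addition and multiplication.  Three facts carry it.

  First, \<open>IsN\<close> propagates backwards along head steps (\<open>IsN_head_expand\<close>): if \<open>t \<rhd> t'\<close> and \<open>t'\<close>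
  denotes a number, then \<open>t = t'\<close> is derivable, and rewriting with this equation turns \<open>IsN t'\<close>
  into \<open>IsN t\<close>.  It therefore suffices to treat the beta-reduced forms of the two functions, which
  are applications of the recursor.

  Secondly, primitive recursion is total (\<open>IsN_Rec\<close>): if \<open>g\<close> denotes a number, and
  \<open>h \<cdot> n \<cdot> r\<close> denotes a number whenever the counter \<open>n\<close> and the previous value \<open>r\<close> do, then
  \<open>Rec \<cdot> g \<cdot> h \<cdot> b\<close> denotes a number for every number \<open>b\<close>.  This is the induction rule applied
  to the statement \<open>IsN (Rec \<cdot> g \<cdot> h \<cdot> n)\<close>.

  Thirdly, \<open>add_tm\<close> is an instance whose step is a successor, and \<open>mult_tm\<close> is one whose step is an
  addition.  The recursion argument of that addition is the previous value of the product, which is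
  a recursor term; hence totality of addition is needed for arbitrary well-formed
  arguments (\<open>IsN_add\<close>) and not only for variables.
\<close>

section \<open>Derivability is closed under the rules\<close>

lemma follows_mono:
  assumes "follows P J" "P \<subseteq> Q"
  shows "follows Q J"
  using assms(1)
proof cases
  case substI
  then show ?thesis using assms(2) follows.substI by blast
next
  case induction
  then show ?thesis using assms(2) follows.induction by blast
qed (use assms(2) in \<open>blast intro: follows.intros\<close>)+

lemma is_proof_append:
  assumes "is_proof js" "is_proof ks"
  shows "is_proof (js @ ks)"
  unfolding is_proof_def
proof (intro HOL.allI impI)
  fix n assume n: "n < length (js @ ks)"
  show "follows (set (take n (js @ ks))) ((js @ ks) ! n)"
  proof (cases "n < length js")
    case True
    then show ?thesis using assms(1) by (simp add: is_proof_def nth_append)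
  next
    case False
    then have "follows (set (take (n - length js) ks)) (ks ! (n - length js))"
      using assms(2) n by (simp add: is_proof_def)
    moreover have "set (take (n - length js) ks) \<subseteq> set (take n (js @ ks))" using False by auto
    ultimately have "follows (set (take n (js @ ks))) (ks ! (n - length js))" by (rule follows_mono)
    then show ?thesis using False by (simp add: nth_append)
  qed
qed

lemma is_proof_snoc:
  assumes "is_proof js" "follows (set js) J"
  shows "is_proof (js @ [J])"
  using assms by (auto simp: is_proof_def nth_append less_Suc_eq)

lemma proof_containing_all:
  assumes "finite Q" "\<And>\<Gamma> c. (\<Gamma>, c) \<in> Q \<Longrightarrow> \<Gamma> \<turnstile> c"
  shows "\<exists>js. is_proof js \<and> Q \<subseteq> set js"
  using assms
proof (induction Q)
  case empty
  have "is_proof []" by (simp add: is_proof_def)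
  then show ?case by blast
next
  case (insert J Q)
  obtain js where js: "is_proof js" "Q \<subseteq> set js" using insert by auto
  obtain ks where ks: "is_proof ks" "J \<in> set ks"
    using insert.prems[of "fst J" "snd J"] by (auto simp: derivable_def)
  have "is_proof (js @ ks)" "insert J Q \<subseteq> set (js @ ks)"
    using js ks is_proof_append by auto
  then show ?case by blast
qed

text \<open>
  A rule has finitely many premises, and proofs of these can be concatenated, so each rule for
  \<open>follows\<close> becomes a rule for \<open>\<turnstile>\<close> by taking \<open>Q\<close> to be its set of premises.
\<close>

lemma derivable_by_rule:
  assumes "follows Q (\<Gamma>, c)" "finite Q" "\<And>\<Delta> d. (\<Delta>, d) \<in> Q \<Longrightarrow> \<Delta> \<turnstile> d"
  shows "\<Gamma> \<turnstile> c"
proof -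
  obtain js where js: "is_proof js" "Q \<subseteq> set js"
    using proof_containing_all assms(2,3) by blast
  then have "is_proof (js @ [(\<Gamma>, c)])"
    using assms(1) is_proof_snoc follows_mono by blast
  then show ?thesis by (auto simp: derivable_def)
qed

lemma derivable_hyp:
  assumes "c |\<in>| \<Gamma>" "wf_tm c"
  shows "\<Gamma> \<turnstile> c"
proof -
  have "follows {} (finsert c \<Gamma>, c)" using assms(2) by (rule follows.hyp)
  then show ?thesis using assms(1) by (auto simp: finsert_absorb intro: derivable_by_rule)
qed

lemma derivable_weaken: "\<Gamma> \<turnstile> c \<Longrightarrow> finsert a \<Gamma> \<turnstile> c"
  by (rule derivable_by_rule[where Q = "{(\<Gamma>, c)}"]) (auto intro: follows.weaken)

lemma derivable_eq_sym: "\<Gamma> \<turnstile> a \<^bold>= b \<Longrightarrow> \<Gamma> \<turnstile> b \<^bold>= a"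
  by (rule derivable_by_rule[where Q = "{(\<Gamma>, a \<^bold>= b)}"]) (auto intro: follows.eq_sym)

lemma derivable_eq_subst:
  "\<Gamma> \<turnstile> a \<^bold>= b \<Longrightarrow> \<Gamma> \<turnstile> tsubst v a p \<Longrightarrow> wf_tm p \<Longrightarrow> \<Gamma> \<turnstile> tsubst v b p"
  by (rule derivable_by_rule[where Q = "{(\<Gamma>, a \<^bold>= b), (\<Gamma>, tsubst v a p)}"])
    (auto intro: follows.eq_subst)

lemma derivable_succ_N: "\<Gamma> \<turnstile> IsN a \<Longrightarrow> \<Gamma> \<turnstile> IsN (Succ a)"
  by (rule derivable_by_rule[where Q = "{(\<Gamma>, IsN a)}"]) (auto intro: follows.succ_NI)

lemma derivable_zero_N: "\<Gamma> \<turnstile> IsN Zero"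
  by (rule derivable_by_rule[OF follows.zero_N finite.emptyI]) simp

lemma derivable_induction:
  assumes "\<Gamma> \<turnstile> tsubst i Zero c"
    "finsert (IsN (Var i)) (finsert c \<Gamma>) \<turnstile> tsubst i (Succ (Var i)) c"
    "\<Gamma> \<turnstile> IsN a" "wf_tm c" "\<And>g. g |\<in>| \<Gamma> \<Longrightarrow> i \<notin> fv g"
  shows "\<Gamma> \<turnstile> tsubst i a c"
  by (rule derivable_by_rule[where Q = "{(\<Gamma>, tsubst i Zero c),
        (finsert (IsN (Var i)) (finsert c \<Gamma>), tsubst i (Succ (Var i)) c), (\<Gamma>, IsN a)}"])
    (use assms in \<open>auto intro: follows.induction\<close>)

lemma derivable_convI: "c \<rhd> c' \<Longrightarrow> \<Gamma> \<turnstile> c' \<Longrightarrow> \<Gamma> \<turnstile> c"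
  by (rule derivable_by_rule[where Q = "{(\<Gamma>, c')}"]) (auto intro: follows.convI)

lemma derivable_conv_eq: "c \<rhd> c' \<Longrightarrow> \<Gamma> \<turnstile> IsN c' \<Longrightarrow> \<Gamma> \<turnstile> c \<^bold>= c'"
  by (rule derivable_by_rule[where Q = "{(\<Gamma>, IsN c')}"]) (auto intro: follows.conv_eq)

lemma derivable_recursor:
  assumes "\<Gamma> \<turnstile> IsN m" "\<Gamma> \<turnstile> IsN (h \<cdot> m \<cdot> (Rec \<cdot> g \<cdot> h \<cdot> m))" "wf_tm g"
  shows "\<Gamma> \<turnstile> Rec \<cdot> g \<cdot> h \<cdot> Succ m \<^bold>= h \<cdot> m \<cdot> (Rec \<cdot> g \<cdot> h \<cdot> m)"
  by (rule derivable_by_rule[where Q = "{(\<Gamma>, IsN m), (\<Gamma>, IsN (h \<cdot> m \<cdot> (Rec \<cdot> g \<cdot> h \<cdot> m)))}"])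
    (use assms in \<open>auto intro: follows.recursor\<close>)

lemma derivable_allI: "finsert (IsN (Var 0)) (up |`| \<Gamma>) \<turnstile> up f \<cdot> Var 0 \<Longrightarrow> \<Gamma> \<turnstile> AllC \<cdot> f"
  by (rule derivable_by_rule[where Q = "{(finsert (IsN (Var 0)) (up |`| \<Gamma>), up f \<cdot> Var 0)}"])
    (auto intro: follows.allI)

section \<open>Substitution and free variables\<close>

lemma tsubst_fresh: "i \<notin> fv t \<Longrightarrow> tsubst i s t = t"
  by (induction t arbitrary: i s) (auto intro!: map_idI)

lemma lift_0 [simp]: "lift 0 c t = t"
  by (induction t arbitrary: c) (auto intro!: map_idI)

lemma inst_lift: "inst i s (lift 1 i t) = t"
  by (induction t arbitrary: i s) (auto intro!: map_idI)

text \<open>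
  Applying a lifted abstraction to \<open>Var 0\<close> gives back its body: the lifting frees the index that
  \<open>Var 0\<close> then takes.  This is the form in which the quantifier rule meets \<open>Forall b\<close>.
\<close>

lemma inst_Var_lift_Suc: "inst i (Var i) (lift 1 (Suc i) t) = t"
  by (induction t arbitrary: i) (auto intro!: map_idI)

lemma finite_fv: "finite (fv t)"
proof (induction t)
  case (Op f k ts)
  have "fv (Op f k ts) = (\<Union>t\<in>set ts. (\<lambda>i. i + k) -` fv t)" by auto
  then show ?case using Op by (simp add: finite_vimageI)
qed simp

lemma exists_fresh_index:
  obtains i where "\<And>g. g |\<in>| \<Gamma> \<Longrightarrow> i \<notin> fv g" "i \<notin> fv a"
proof -
  have "finite (fv a \<union> (\<Union>g\<in>fset \<Gamma>. fv g))" by (simp add: finite_fv)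
  then obtain i where "i \<notin> fv a \<union> (\<Union>g\<in>fset \<Gamma>. fv g)"
    using ex_new_if_finite infinite_UNIV_nat by blast
  then show ?thesis using that by auto
qed

section \<open>Derived rules for numberhood and quantification\<close>

lemma IsN_rewrite:
  assumes "\<Gamma> \<turnstile> a \<^bold>= b" "\<Gamma> \<turnstile> IsN b"
  shows "\<Gamma> \<turnstile> IsN a"
  using derivable_eq_subst[OF derivable_eq_sym[OF assms(1)], of 0 "IsN (Var 0)"] assms(2)
  by (simp add: wf_tm.intros)

lemma IsN_head_expand: "t \<rhd> t' \<Longrightarrow> \<Gamma> \<turnstile> IsN t' \<Longrightarrow> \<Gamma> \<turnstile> IsN t"
  using IsN_rewrite derivable_conv_eq by blast

lemma IsN_beta2:
  assumes "wf_tm a" "wf_tm b" "\<Gamma> \<turnstile> IsN (inst 0 b (inst 1 (up a) t))"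
  shows "\<Gamma> \<turnstile> IsN (Lam (Lam t) \<cdot> a \<cdot> b)"
proof (rule IsN_head_expand)
  have "Lam (Lam t) \<cdot> a \<rhd> Lam (inst 1 (up a) t)"
    using head_step.beta[OF assms(1), of "Lam t"] by simp
  then show "Lam (Lam t) \<cdot> a \<cdot> b \<rhd> Lam (inst 1 (up a) t) \<cdot> b"
    by (rule head_step.app)
  show "\<Gamma> \<turnstile> IsN (Lam (inst 1 (up a) t) \<cdot> b)"
    using head_step.beta[OF assms(2)] assms(3) by (rule IsN_head_expand)
qed

lemma derivable_ForallI:
  assumes "finsert (IsN (Var 0)) (up |`| \<Gamma>) \<turnstile> b"
  shows "\<Gamma> \<turnstile> Forall b"
proof (rule derivable_allI)
  have "up (Lam b) \<cdot> Var 0 \<rhd> b"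
    using head_step.beta[of "Var 0" "lift 1 1 b"] inst_Var_lift_Suc[of 0 b]
    by (simp add: wf_tm.intros)
  then show "finsert (IsN (Var 0)) (up |`| \<Gamma>) \<turnstile> up (Lam b) \<cdot> Var 0"
    using assms by (rule derivable_convI)
qed

text \<open>
  The recursor rule yields its equation only once the right-hand side is known to denote a number,
  which is exactly what the step hypothesis provides.  The induction hypothesis is the second
  assumption of that step, and the counter \<open>i\<close> must be fresh for the induction rule.
\<close>

lemma IsN_Rec:
  assumes wf: "wf_tm g" "wf_tm h"
    and fresh: "\<And>c. c |\<in>| \<Gamma> \<Longrightarrow> i \<notin> fv c" "i \<notin> fv g" "i \<notin> fv h"
    and start: "\<Gamma> \<turnstile> IsN g"
    and step: "finsert (IsN (Var i)) (finsert (IsN (Rec \<cdot> g \<cdot> h \<cdot> Var i)) \<Gamma>)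
      \<turnstile> IsN (h \<cdot> Var i \<cdot> (Rec \<cdot> g \<cdot> h \<cdot> Var i))"
    and arg: "\<Gamma> \<turnstile> IsN b"
  shows "\<Gamma> \<turnstile> IsN (Rec \<cdot> g \<cdot> h \<cdot> b)"
proof -
  let ?c = "IsN (Rec \<cdot> g \<cdot> h \<cdot> Var i)"
  let ?\<Delta> = "finsert (IsN (Var i)) (finsert ?c \<Gamma>)"
  have c_subst: "tsubst i s ?c = IsN (Rec \<cdot> g \<cdot> h \<cdot> s)" for s
    using fresh by (simp add: tsubst_fresh)
  have "\<Gamma> \<turnstile> IsN (Rec \<cdot> g \<cdot> h \<cdot> Zero)"
    using head_step.rec_zero[OF wf(2)] start by (rule IsN_head_expand)
  moreover have "?\<Delta> \<turnstile> IsN (Rec \<cdot> g \<cdot> h \<cdot> Succ (Var i))"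
  proof (rule IsN_rewrite[OF derivable_recursor step])
    show "?\<Delta> \<turnstile> IsN (Var i)" by (rule derivable_hyp) (auto intro: wf_tm.intros)
  qed (use step wf in auto)
  moreover have "wf_tm ?c" using wf by (intro wf_tm.intros)
  ultimately have "\<Gamma> \<turnstile> tsubst i b ?c"
    using arg fresh(1) derivable_induction[of \<Gamma> i ?c b] unfolding c_subst by blast
  then show ?thesis by (simp only: c_subst)
qed

section \<open>Totality of addition and multiplication\<close>

lemma IsN_add:
  assumes wf: "wf_tm a" "wf_tm b" and a: "\<Gamma> \<turnstile> IsN a" and b: "\<Gamma> \<turnstile> IsN b"
  shows "\<Gamma> \<turnstile> IsN (add_tm \<cdot> a \<cdot> b)"
proof -
  let ?h = "Lam (Lam (Succ (Var 0)))"
  obtain i where i: "\<And>c. c |\<in>| \<Gamma> \<Longrightarrow> i \<notin> fv c" "i \<notin> fv a"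
    using exists_fresh_index[of \<Gamma> a] by blast
  have "\<Gamma> \<turnstile> IsN (Rec \<cdot> a \<cdot> ?h \<cdot> b)"
  proof (rule IsN_Rec)
    let ?r = "Rec \<cdot> a \<cdot> ?h \<cdot> Var i"
    let ?\<Delta> = "finsert (IsN (Var i)) (finsert (IsN ?r) \<Gamma>)"
    have wf_r: "wf_tm ?r" using wf by (intro wf_tm.intros)
    then have "?\<Delta> \<turnstile> IsN ?r" by (intro derivable_hyp) (auto intro: wf_tm.intros)
    then show "?\<Delta> \<turnstile> IsN (?h \<cdot> Var i \<cdot> ?r)"
      using wf_r by (intro IsN_beta2) (auto intro: wf_tm.intros derivable_succ_N)
    show "wf_tm ?h" by (intro wf_tm.intros)
  qed (use assms i in auto)
  then show ?thesis
    unfolding add_tm_def using wf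
    by (intro IsN_beta2) (auto simp: inst_lift[simplified])
qed

text \<open>
  The arguments are variables so that the substitutions produced by beta reduction can be computed.
  The step function adds \<open>Var x\<close> to the previous value, written inside it as \<open>Var (Suc (Suc x))\<close>
  because it stands below two abstractions.
\<close>

lemma IsN_mult:
  assumes x: "\<Gamma> \<turnstile> IsN (Var x)" and y: "\<Gamma> \<turnstile> IsN (Var y)"
  shows "\<Gamma> \<turnstile> IsN (mult_tm \<cdot> Var x \<cdot> Var y)"
proof -
  let ?h = "Lam (Lam (add_tm \<cdot> Var (Suc (Suc x)) \<cdot> Var 0))"
  obtain i where i: "\<And>c. c |\<in>| \<Gamma> \<Longrightarrow> i \<notin> fv c" "i \<notin> fv (Var x)"
    using exists_fresh_index[of \<Gamma> "Var x"] by blast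
  have wf_h: "wf_tm ?h" unfolding add_tm_def by (intro wf_tm.intros)
  have "\<Gamma> \<turnstile> IsN (Rec \<cdot> Zero \<cdot> ?h \<cdot> Var y)"
  proof (rule IsN_Rec)
    let ?r = "Rec \<cdot> Zero \<cdot> ?h \<cdot> Var i"
    let ?\<Delta> = "finsert (IsN (Var i)) (finsert (IsN ?r) \<Gamma>)"
    have wf_r: "wf_tm ?r" by (rule wf_h wf_tm.intros)+
    have "?\<Delta> \<turnstile> IsN (Var x)" using x by (intro derivable_weaken)
    moreover have "?\<Delta> \<turnstile> IsN ?r" using wf_r by (intro derivable_hyp) (auto intro: wf_tm.intros)
    ultimately have "?\<Delta> \<turnstile> IsN (add_tm \<cdot> Var x \<cdot> ?r)"
      using wf_r by (intro IsN_add) (auto intro: wf_tm.intros)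
    then show "?\<Delta> \<turnstile> IsN (?h \<cdot> Var i \<cdot> ?r)"
      using wf_r by (intro IsN_beta2) (auto simp: add_tm_def intro: wf_tm.intros)
    show "wf_tm Zero" by (rule wf_tm.intros)
    show "\<Gamma> \<turnstile> IsN Zero" by (rule derivable_zero_N)
  qed (use y i wf_h in \<open>auto simp: add_tm_def\<close>)
  then show ?thesis
    unfolding mult_tm_def
    by (intro IsN_beta2) (auto simp: add_tm_def numeral_eq_Suc intro: wf_tm.intros)
qed

theorem theorem5p4:
  shows "{||} \<turnstile> Forall (Forall (IsN (add_tm \<cdot> Var 1 \<cdot> Var 0)))
       \<and> {||} \<turnstile> Forall (Forall (IsN (mult_tm \<cdot> Var 1 \<cdot> Var 0)))"
proof -
  let ?\<Gamma> = "{|IsN (Var 0), IsN (Var 1)|}"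
  have ForallForall: "{||} \<turnstile> Forall (Forall c)" if "?\<Gamma> \<turnstile> c" for c
    using that by (intro derivable_ForallI) simp
  have "?\<Gamma> \<turnstile> IsN (Var 0)" "?\<Gamma> \<turnstile> IsN (Var 1)"
    by (auto intro!: derivable_hyp wf_tm.intros)
  then show ?thesis
    by (intro conjI ForallForall IsN_add IsN_mult wf_tm.intros)
qed

end
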